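(* For any index $\mathbf{k}=(k_1,\ldots,k_r)$ with $r\ge 2$, the limit \[\Omega(\mathbf{k}) := \lim_{n\to\infty}\omega_n(\mathbf{k};e^{2\pi i/n})\] exists, and \[\Omega(\mathbf{k})=\sum_{a=1}^r (-1)^{k_a}\,\zeta^{MT}(k_1,\ldots,k_{a-1},k_{a+1},\ldots,k_r;k_a).\]
   Context: An index is a tuple of positive integers. With $[m]=\frac{1-q^m}{1-q}$, define $\omega_n(\mathbf{k};q)=\sum_{m_1+\cdots+m_r=n,\ m_i>0}\prod_{a=1}^r \frac{q^{(k_a-1)m_a}}{[m_a]^{k_a}}$, evaluated at $q=e^{2\pi i/n}$ (well defined since $r\ge2$ forces all $m_a<n$). The Mordell–Tornheim multiple zeta value is, for positive integers $l_1,\ldots,l_s$ ($s\ge1$) and $l\ge1$, $\zeta^{MT}(l_1,\ldots,l_s;l)=\sum_{m_1,\ldots,m_s>0}\frac{1}{m_1^{l_1}\cdots m_s^{l_s}(m_1+\cdots+m_s)^{l}}$. *)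

theory Defs
  imports "HOL-Analysis.Analysis"
begin

definition is_index :: "nat list \<Rightarrow> bool" where
  "is_index ks \<longleftrightarrow> (\<forall>k\<in>set ks. k > 0)"

definition q_int :: "complex \<Rightarrow> nat \<Rightarrow> complex" where
  "q_int q m = (1 - q ^ m) / (1 - q)"

definition compositions :: "nat \<Rightarrow> nat \<Rightarrow> nat list set" where
  "compositions r n = {ms. length ms = r \<and> (\<forall>m\<in>set ms. m > 0) \<and> sum_list ms = n}"

definition omega :: "nat \<Rightarrow> nat list \<Rightarrow> complex \<Rightarrow> complex" where
  "omega n ks q =
     (\<Sum>ms\<in>compositions (length ks) n.
        \<Prod>a<length ks. q ^ ((ks ! a - 1) * ms ! a) / q_int q (ms ! a) ^ (ks ! a))"

definition omega_root :: "nat list \<Rightarrow> nat \<Rightarrow> complex" where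
  "omega_root ks n = omega n ks (exp (2 * complex_of_real pi * \<i> / of_nat n))"

definition Omega :: "nat list \<Rightarrow> complex" where
  "Omega ks = lim (omega_root ks)"

text \<open>The summands are positive, and the family is summable whenever \<open>ls\<close> is a nonempty list of
  positive integers and \<open>l > 0\<close>: each \<open>m\<^sub>i\<close> is at most the total \<open>m\<^sub>1 + \<dots> + m\<^sub>s\<close>, so a summand is
  at most \<open>\<Prod>\<^sub>i m\<^sub>i powr (- 1 - 1 / s)\<close>. Hence the unordered sum is the value of the series there.\<close>

definition zeta_MT :: "nat list \<Rightarrow> nat \<Rightarrow> real" where
  "zeta_MT ls l =
     (\<Sum>\<^sub>\<infinity>ms\<in>{ms. length ms = length ls \<and> (\<forall>m\<in>set ms. m > 0)}.
        1 / ((\<Prod>i<length ls. real (ms ! i) ^ (ls ! i)) * real (sum_list ms) ^ l))"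

definition remove_nth :: "nat \<Rightarrow> 'a list \<Rightarrow> 'a list" where
  "remove_nth a xs = take a xs @ drop (Suc a) xs"

end

theory Submission
  imports Defs
begin

text \<open>
  Group the compositions of \<open>n\<close> by the position \<open>a\<close> of a largest part, and index those in group \<open>a\<close>
  by the list \<open>xs\<close> of their other parts, with total \<open>M\<close>, so that the part at \<open>a\<close> is \<open>n - M\<close>.
  For fixed \<open>xs\<close>, the brackets satisfy \<open>[m] \<rightarrow> m\<close> and \<open>[n - M] = - q\<^bsup>-M\<^esup> [M] \<rightarrow> - M\<close>, which produces the
  Mordell--Tornheim summand with the sign \<open>(-1)\<^bsup>k\<^esup>\<close>, \<open>k\<close> being the entry of the index at \<open>a\<close>.
  Jordan's inequality gives \<open>|[m]| \<ge> (2 / \<pi>) min m (n - m)\<close>. Since the part at \<open>a\<close> is largest, this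
  minimum is \<open>m\<close> for the other parts and at least \<open>M / (r - 1)\<close> for the part at \<open>a\<close>. Hence a
  constant multiple of the Mordell--Tornheim summand dominates, uniformly in \<open>n\<close>, and dominated
  convergence applies to each group.
\<close>

section \<open>Jordan's inequality and dominated convergence\<close>

text \<open>Concavity puts the sine above its chord from \<open>0\<close> to
  \<open>pi / 2\<close>.\<close>

lemma sin_ge_linear:
  fixes x :: real
  assumes "0 \<le> x" "x \<le> pi / 2"
  shows "2 / pi * x \<le> sin x"
proof -
  have conc: "concave_on {0..pi/2} sin"
    by (rule f''_le0_imp_concave[where f' = cos and f'' = "\<lambda>x. - sin x"])
      (auto intro!: derivative_eq_intros sin_ge_zero)
  show ?thesis
    using concave_onD_Icc'[OF conc, of x] assms by simp
qed

text \<open>Absolutely convergent unordered sums are Bochner integrals for the counting measure, so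
  this is an instance of Lebesgue's theorem.\<close>

lemma tendsto_infsum_dominated:
  fixes f :: "nat \<Rightarrow> 'a \<Rightarrow> 'b::{banach, second_countable_topology}"
  assumes g: "g summable_on A"
    and bound: "\<And>n x. x \<in> A \<Longrightarrow> norm (f n x) \<le> g x"
    and lim: "\<And>x. x \<in> A \<Longrightarrow> (\<lambda>n. f n x) \<longlonglongrightarrow> h x"
  shows "(\<lambda>n. infsum (f n) A) \<longlonglongrightarrow> infsum h A"
proof -
  \<comment> \<open>Being an upper bound for norms, \<open>g\<close> is nonnegative on
    \<open>A\<close>, so its summability is integrability.\<close>
  have "0 \<le> g x" if "x \<in> A" for x
    using bound[OF that, of 0] norm_ge_zero order_trans by blast
  then have "(\<lambda>x. norm (g x)) summable_on A"
    using g by (subst summable_on_cong[of _ _ g]) auto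
  then have intg: "integrable (count_space A) g"
    by (simp only: abs_summable_equivalent abs_summable_on_def)
  note dom = integrable_dominated_convergence integrable_dominated_convergence2 integral_dominated_convergence
  have "integrable (count_space A) h" "integrable (count_space A) (f n)"
    "(\<lambda>n. integral\<^sup>L (count_space A) (f n)) \<longlonglongrightarrow> integral\<^sup>L (count_space A) h" for n
    by (rule dom[OF _ _ intg, of h f]; simp add: AE_count_space bound lim)+
  then show ?thesis
    by (simp flip: infsetsum_infsum add: abs_summable_on_def infsetsum_def)
qed

section \<open>Convergence of the Mordell--Tornheim series\<close>

text \<open>The index set of the series in \<open>zeta_MT\<close>, with the number of variables as
  parameter.\<close>

definition pos_lists :: "nat \<Rightarrow> nat list set" where
  "pos_lists s = {ms. length ms = s \<and> (\<forall>m\<in>set ms. m > 0)}"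

text \<open>Expanding the power by distributivity gives one product for each list of
  \<open>s\<close> elements of \<open>A\<close>; the induction splits off the head of the
  list.\<close>

lemma sum_prod_list_lists_length_eq:
  fixes h :: "'a \<Rightarrow> 'b::comm_semiring_1"
  assumes "finite A"
  shows "(\<Sum>xs | set xs \<subseteq> A \<and> length xs = s. prod_list (map h xs)) = (\<Sum>x\<in>A. h x) ^ s"
proof (induction s)
  case 0
  have "{xs. set xs \<subseteq> A \<and> length xs = 0} = {[]}" by auto
  then show ?case by simp
next
  case (Suc s)
  have "(\<Sum>xs | set xs \<subseteq> A \<and> length xs = Suc s. prod_list (map h xs)) =
      (\<Sum>(x, xs) \<in> A \<times> {xs. set xs \<subseteq> A \<and> length xs = s}. h x * prod_list (map h xs))"
    by (rule sum.reindex_bij_witness[of _ "\<lambda>(x, xs). x # xs" "\<lambda>xs. (hd xs, tl xs)"])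
      (auto simp: length_Suc_conv)
  also have "\<dots> = (\<Sum>x\<in>A. h x) * (\<Sum>x\<in>A. h x) ^ s"
    by (simp add: sum_product flip: sum.cartesian_product Suc.IH)
  finally show ?case by simp
qed

text \<open>Any finite set of lists lies in a cube, whose sum factors into the power of a single
  finite sum. This bounds all finite partial sums by \<open>suminf h ^ s\<close>.\<close>

lemma summable_on_prod_list_pos_lists:
  fixes h :: "nat \<Rightarrow> real"
  assumes "summable h" and nonneg: "\<And>n. 0 \<le> h n"
  shows "(\<lambda>ms. prod_list (map h ms)) summable_on pos_lists s"
proof (rule nonneg_bdd_above_summable_on)
  have prod_nonneg: "0 \<le> prod_list (map h ms)" for ms
    by (induction ms) (auto simp: nonneg)
  show "0 \<le> prod_list (map h ms)" for ms by (rule prod_nonneg)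
  show "bdd_above (sum (\<lambda>ms. prod_list (map h ms)) ` {F. F \<subseteq> pos_lists s \<and> finite F})"
  proof (rule bdd_aboveI2)
    fix F assume "F \<in> {F. F \<subseteq> pos_lists s \<and> finite F}"
    then have F: "F \<subseteq> pos_lists s" "finite F" by auto
    define A where "A = \<Union> (set ` F)"
    have A: "finite A" using F by (auto simp: A_def)
    have "(\<Sum>ms\<in>F. prod_list (map h ms)) \<le> (\<Sum>xs | set xs \<subseteq> A \<and> length xs = s. prod_list (map h xs))"
      using F by (intro sum_mono2 finite_lists_length_eq A prod_nonneg)
        (auto simp: A_def pos_lists_def)
    also have "\<dots> = (\<Sum>x\<in>A. h x) ^ s"
      by (rule sum_prod_list_lists_length_eq[OF A])
    also have "\<dots> \<le> suminf h ^ s"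
      by (intro power_mono sum_le_suminf assms A sum_nonneg ballI)
    finally show "(\<Sum>ms\<in>F. prod_list (map h ms)) \<le> suminf h ^ s" .
  qed
qed

lemma prod_nth_eq_prod_list:
  assumes "length ms = n"
  shows "(\<Prod>i<n. f (ms ! i)) = prod_list (map f ms)"
  using assms by (simp add: prod.list_conv_set_nth atLeast0LessThan)

lemma zeta_MT_summable:
  assumes ls: "is_index ls" "ls \<noteq> []" and l: "0 < l"
  shows "(\<lambda>ms. 1 / ((\<Prod>i<length ls. real (ms ! i) ^ (ls ! i)) * real (sum_list ms) ^ l))
           summable_on pos_lists (length ls)"
proof -
  define s where "s = length ls"
  have s: "s > 0" using ls by (simp add: s_def)
  \<comment> \<open>The exponent \<open>- 1\<close> comes from the entries of \<open>ls\<close>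
    being at least 1. The extra \<open>- 1 / s\<close> is an equal share of one power of the total:
    each of the \<open>s\<close> entries is at most the total.\<close>
  define h where "h = (\<lambda>m::nat. real m powr (- 1 - 1 / real s))"
  have "summable h"
    unfolding h_def by (subst summable_real_powr_iff) (use s in auto)
  then have "(\<lambda>ms. prod_list (map h ms)) summable_on pos_lists s"
    by (rule summable_on_prod_list_pos_lists) (simp add: h_def)
  then show ?thesis unfolding s_def[symmetric]
  proof (rule summable_on_comparison_test)
    fix ms assume "ms \<in> pos_lists s"
    then have len: "length ms = s" and pos: "\<And>i. i < s \<Longrightarrow> 0 < ms ! i"
      by (auto simp: pos_lists_def)
    have le: "ms ! i \<le> sum_list ms" if "i < s" for i
      using that len by (simp add: elem_le_sum_list)
    define M where "M = real (sum_list ms)"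
    have M: "M \<ge> 1" using le[of 0] pos[of 0] s by (simp add: M_def)
    have "(\<Prod>i<s. real (ms ! i) powr (1 / s)) \<le> (\<Prod>i<s. M powr (1 / s))"
      using le by (intro prod_mono) (auto simp: M_def intro!: powr_mono2)
    also have "\<dots> = M" using M s by (simp add: powr_powr flip: powr_realpow)
    also have "\<dots> \<le> M ^ l" using M l by (simp add: self_le_power)
    finally have 1: "(\<Prod>i<s. real (ms ! i) powr (1 / s)) \<le> M ^ l" .
    have 2: "(\<Prod>i<s. real (ms ! i)) \<le> (\<Prod>i<s. real (ms ! i) ^ (ls ! i))"
    proof (intro prod_mono conjI)
      fix i assume i: "i \<in> {..<s}"
      then have "0 < ls ! i" using ls by (auto simp: is_index_def s_def)
      then show "real (ms ! i) \<le> real (ms ! i) ^ (ls ! i)"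
        using pos[of i] i by (intro self_le_power) auto
    qed auto
    have "prod_list (map h ms) = (\<Prod>i<s. h (ms ! i))"
      using prod_nth_eq_prod_list[OF len] by metis
    also have "\<dots> = 1 / ((\<Prod>i<s. real (ms ! i)) * (\<Prod>i<s. real (ms ! i) powr (1 / s)))"
    proof -
      have "h (ms ! i) = inverse (real (ms ! i) * real (ms ! i) powr (1 / s))" if "i < s" for i
        using pos[OF that] by (simp add: h_def powr_diff powr_minus field_simps)
      then show ?thesis
        by (simp add: inverse_eq_divide prod_dividef flip: prod.distrib)
    qed
    finally show "1 / ((\<Prod>i<s. real (ms ! i) ^ (ls ! i)) * real (sum_list ms) ^ l) \<le> prod_list (map h ms)"
      using 1 2 pos M unfolding M_def[symmetric]
      by (auto intro!: divide_left_mono mult_mono mult_pos_pos prod_pos prod_nonneg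
           intro: less_le_trans)
    show "0 \<le> 1 / ((\<Prod>i<s. real (ms ! i) ^ (ls ! i)) * real (sum_list ms) ^ l)"
      by (intro divide_nonneg_nonneg mult_nonneg_nonneg prod_nonneg) auto
  qed
qed

section \<open>The bracket \<open>[m]\<close> at a root of unity\<close>

definition unity_root :: "nat \<Rightarrow> complex" where
  "unity_root n = exp (2 * complex_of_real pi * \<i> / of_nat n)"

text \<open>One factor of the product in \<open>omega\<close>, at the root of unity that
  \<open>omega_root\<close> uses.\<close>

definition summand :: "nat \<Rightarrow> nat \<Rightarrow> nat \<Rightarrow> complex" where
  "summand n k m = unity_root n ^ ((k - 1) * m) / q_int (unity_root n) m ^ k"

lemma unity_root_nonzero [simp]: "unity_root n \<noteq> 0"
  by (simp add: unity_root_def)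

lemma norm_unity_root [simp]: "norm (unity_root n) = 1"
  by (simp add: unity_root_def norm_exp_eq_Re)

lemma unity_root_power_self: "n > 0 \<Longrightarrow> unity_root n ^ n = 1"
  by (simp add: unity_root_def flip: exp_of_nat_mult)

text \<open>The chord of the unit circle that spans the angle \<open>2 * pi * m / n\<close>. For
  \<open>n = 0\<close> division by zero makes both sides vanish.\<close>

lemma norm_one_minus_unity_root_power:
  "norm (1 - unity_root n ^ m) = 2 * \<bar>sin (pi * m / n)\<bar>"
proof -
  have "unity_root n ^ m = exp (\<i> * of_real (2 * pi * m / n))"
    by (simp add: unity_root_def field_simps flip: exp_of_nat_mult)
  then show ?thesis
    by (metis dist_exp_i_1 norm_minus_commute times_divide_eq_right mult.assoc 
      nonzero_mult_div_cancel_left zero_neq_numeral)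
qed

lemma unity_root_neq_1: "n \<ge> 2 \<Longrightarrow> unity_root n \<noteq> 1"
proof
  assume n: "n \<ge> 2" and "unity_root n = 1"
  then have "sin (pi / n) = 0"
    using norm_one_minus_unity_root_power[of n 1] by simp
  moreover have "0 < sin (pi / n)"
    using n by (intro sin_gt_zero) (auto simp: field_simps)
  ultimately show False by simp
qed

text \<open>The norm of the bracket is a quotient of two sines. Reflection at \<open>pi / 2\<close>
  replaces \<open>m\<close> by the smaller of \<open>m\<close> and \<open>n - m\<close>; then
  Jordan's inequality bounds the numerator from below and \<open>sin x \<le> x\<close> the
  denominator from above.\<close>

lemma norm_q_int_unity_root_ge:
  assumes m: "0 < m" "m < n"
  shows "2 / pi * min (real m) (real n - real m) \<le> norm (q_int (unity_root n) m)"
proof -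
  have n: "n \<ge> 2" using m by simp
  define d where "d = min (real m) (real n - real m)"
  have 1: "0 < sin (pi / n)"
    using n by (intro sin_gt_zero) (auto simp: field_simps)
  have 4: "sin (pi / n) \<le> pi / n"
    by (rule sin_x_le_x) simp
  have d: "0 \<le> pi * d / n" "pi * d / n \<le> pi / 2"
    using m by (auto simp: d_def field_simps min_def)
  have "sin (pi * m / n) = sin (pi * d / n)"
  proof (cases "d = m")
    case False
    then have "pi * m / n = pi - pi * d / n"
      using m by (auto simp: d_def min_def field_simps split: if_splits)
    then show ?thesis by simp
  qed simp
  then have 2: "2 * d / n \<le> sin (pi * m / n)"
    using sin_ge_linear[OF d] by simp
  have 3: "0 \<le> 2 * d / n" using m by (simp add: d_def)
  have "2 / pi * d = (2 * d / n) / (pi / n)" using n by simp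
  also have "\<dots> \<le> sin (pi * m / n) / sin (pi / n)"
    using 1 2 3 4 by (intro frac_le) auto
  also have "\<dots> = norm (q_int (unity_root n) m)"
    using 1 2 3 norm_one_minus_unity_root_power[of n m] norm_one_minus_unity_root_power[of n 1]
    by (simp add: q_int_def norm_divide)
  finally show ?thesis by (simp add: d_def)
qed

text \<open>The numerator has norm 1, so only the bracket matters. The real number \<open>d\<close>
  is left free because it will be the part itself for the other parts, but an average of these for
  the largest part.\<close>

lemma norm_summand_le:
  assumes m: "0 < m" "m < n" and d: "0 < d" "d \<le> real m" "d \<le> real n - real m"
  shows "norm (summand n k m) \<le> (pi / 2) ^ k / d ^ k"
proof -
  have "2 / pi * d \<le> 2 / pi * min (real m) (real n - real m)"
    using d by (intro mult_left_mono) auto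
  also have "\<dots> \<le> norm (q_int (unity_root n) m)"
    by (rule norm_q_int_unity_root_ge[OF m])
  finally have "(2 / pi * d) ^ k \<le> norm (q_int (unity_root n) m) ^ k"
    using d by (intro power_mono) auto
  moreover have "0 < (2 / pi * d) ^ k" using d by simp
  ultimately have "1 / norm (q_int (unity_root n) m) ^ k \<le> 1 / (2 / pi * d) ^ k"
    by (intro divide_left_mono mult_pos_pos) linarith+
  also have "\<dots> = (pi / 2) ^ k / d ^ k"
    using d by (simp add: power_mult_distrib power_divide)
  finally show ?thesis
    by (simp add: summand_def norm_divide norm_power)
qed

lemma tendsto_unity_root: "unity_root \<longlonglongrightarrow> 1"
proof -
  have "(\<lambda>n. 2 * complex_of_real pi * \<i> / of_nat n) \<longlonglongrightarrow> 0"
    by (rule tendsto_divide_0[OF tendsto_const]) (rule tendsto_of_nat)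
  from tendsto_exp[OF this] show ?thesis
    by (simp add: unity_root_def[abs_def])
qed

text \<open>Away from \<open>q = 1\<close> the bracket is a geometric sum with \<open>m\<close>
  terms, each of which tends to 1.\<close>

lemma tendsto_q_int_unity_root: "(\<lambda>n. q_int (unity_root n) m) \<longlonglongrightarrow> of_nat m"
proof -
  have "(\<lambda>n. \<Sum>i<m. unity_root n ^ i) \<longlonglongrightarrow> (\<Sum>i<m. 1 ^ i)"
    by (intro tendsto_intros tendsto_unity_root)
  moreover have "\<forall>\<^sub>F n in sequentially. (\<Sum>i<m. unity_root n ^ i) = q_int (unity_root n) m"
    using eventually_ge_at_top[of 2]
  proof eventually_elim
    case (elim n)
    then show ?case
      using unity_root_neq_1[OF elim] by (simp add: q_int_def sum_gp_strict)
  qed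
  ultimately show ?thesis
    by (auto intro: Lim_transform_eventually)
qed

lemma tendsto_summand:
  assumes "m > 0"
  shows "(\<lambda>n. summand n k m) \<longlonglongrightarrow> 1 / of_nat m ^ k"
proof -
  have "(\<lambda>n. summand n k m) \<longlonglongrightarrow> 1 ^ ((k - 1) * m) / of_nat m ^ k"
    unfolding summand_def using assms
    by (intro tendsto_intros tendsto_unity_root tendsto_q_int_unity_root) auto
  then show ?thesis by simp
qed

text \<open>Since the \<open>n\<close>-th power of the root is 1, its power \<open>n - m\<close> is
  the inverse of its power \<open>m\<close>. This turns the bracket of \<open>n - m\<close> into
  that of the fixed number \<open>m\<close> and produces the sign.\<close>

lemma tendsto_summand_diff:
  assumes "m > 0"
  shows "(\<lambda>n. summand n k (n - m)) \<longlonglongrightarrow> (-1) ^ k / of_nat m ^ k"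
proof -
  let ?q = unity_root
  have "(\<lambda>n. (1 / ?q n ^ m) ^ (k - 1) / (- q_int (?q n) m / ?q n ^ m) ^ k)
      \<longlonglongrightarrow> (1 / 1 ^ m) ^ (k - 1) / (- of_nat m / 1 ^ m) ^ k"
    using assms
    by (intro tendsto_intros tendsto_unity_root tendsto_q_int_unity_root) auto
  also have "(1 / 1 ^ m) ^ (k - 1) / (- of_nat m / 1 ^ m) ^ k = ((-1) ^ k / of_nat m ^ k :: complex)"
    by (cases "even k") simp_all
  finally have lim: "(\<lambda>n. (1 / ?q n ^ m) ^ (k - 1) / (- q_int (?q n) m / ?q n ^ m) ^ k)
      \<longlonglongrightarrow> (-1) ^ k / of_nat m ^ k" .
  have "\<forall>\<^sub>F n in sequentially.
      (1 / ?q n ^ m) ^ (k - 1) / (- q_int (?q n) m / ?q n ^ m) ^ k = summand n k (n - m)"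
    \<comment> \<open>This makes the subtraction \<open>n - m\<close> exact and also gives
      \<open>n \<ge> 2\<close>, so that the root differs from 1.\<close>
    using eventually_ge_at_top[of "m + 2"]
  proof eventually_elim
    case (elim n)
    then have "?q n ^ (n - m) * ?q n ^ m = 1"
      by (simp add: unity_root_power_self flip: power_add)
    then have *: "?q n ^ (n - m) = 1 / ?q n ^ m"
      by (simp add: field_simps)
    have "q_int (?q n) (n - m) = - q_int (?q n) m / ?q n ^ m"
      using unity_root_neq_1[of n] elim by (simp add: q_int_def * field_simps)
    moreover have "?q n ^ ((k - 1) * (n - m)) = (1 / ?q n ^ m) ^ (k - 1)"
      by (metis * power_mult mult.commute)
    ultimately show ?case
      by (simp only: summand_def)
  qed
  with lim show ?thesis by (rule Lim_transform_eventually)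
qed

section \<open>Lists with one entry inserted or removed\<close>

text \<open>Undoes \<open>remove_nth\<close>: it restores a composition from its other parts and the
  part at \<open>a\<close>.\<close>

definition insert_nth :: "nat \<Rightarrow> 'a \<Rightarrow> 'a list \<Rightarrow> 'a list" where
  "insert_nth a y xs = take a xs @ y # drop a xs"

lemma length_insert_nth [simp]: "length (insert_nth a y xs) = Suc (length xs)"
  by (simp add: insert_nth_def)

lemma insert_nth_neq_Nil [simp]: "insert_nth a y xs \<noteq> []"
  by (simp add: insert_nth_def)

lemma length_remove_nth [simp]: "a < length xs \<Longrightarrow> length (remove_nth a xs) = length xs - 1"
  by (simp add: remove_nth_def)

lemma set_insert_nth [simp]: "set (insert_nth a y xs) = insert y (set xs)"
  by (metis insert_nth_def append_take_drop_id set_append list.simps(15) Un_insert_right)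

lemma set_remove_nth_subset: "set (remove_nth a xs) \<subseteq> set xs"
  by (auto simp: remove_nth_def dest: in_set_takeD in_set_dropD)

lemma sum_list_insert_nth [simp]:
  fixes y :: "'a::comm_monoid_add"
  shows "sum_list (insert_nth a y xs) = y + sum_list xs"
proof -
  have "sum_list xs = sum_list (take a xs) + sum_list (drop a xs)"
    by (metis append_take_drop_id sum_list_append)
  then show ?thesis by (simp add: insert_nth_def add_ac)
qed

lemma nth_insert_nth:
  assumes "a \<le> length xs" "i \<le> length xs"
  shows "insert_nth a y xs ! i = (if i < a then xs ! i else if i = a then y else xs ! (i - 1))"
  using assms by (auto simp: insert_nth_def nth_append min_def nth_Cons' Suc_diff_le)

lemma remove_nth_insert_nth [simp]: "a \<le> length xs \<Longrightarrow> remove_nth a (insert_nth a y xs) = xs"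
  by (simp add: insert_nth_def remove_nth_def min_def)

lemma insert_nth_remove_nth [simp]:
  "a < length xs \<Longrightarrow> insert_nth a (xs ! a) (remove_nth a xs) = xs"
  by (simp add: insert_nth_def remove_nth_def min_def id_take_nth_drop[symmetric])

lemma prod_nth2_eq_prod_list:
  assumes "length xs = n" "length ys = n"
  shows "(\<Prod>i<n. F (xs ! i) (ys ! i)) = prod_list (map2 F xs ys)"
  using assms by (simp add: prod.list_conv_set_nth atLeast0LessThan)

text \<open>Cutting both lists at \<open>a\<close> and multiplying over the zipped pieces avoids
  reindexing the product.\<close>

lemma prod_insert_nth:
  fixes F :: "'a \<Rightarrow> 'b \<Rightarrow> 'c::comm_monoid_mult"
  assumes "length ks = Suc s" "length xs = s" "a \<le> s"
  shows "(\<Prod>i<Suc s. F (ks ! i) (insert_nth a y xs ! i)) =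
           F (ks ! a) y * (\<Prod>i<s. F (remove_nth a ks ! i) (xs ! i))"
proof -
  have ks: "ks = take a ks @ ks ! a # drop (Suc a) ks"
    using assms by (intro id_take_nth_drop) simp
  have "(\<Prod>i<Suc s. F (ks ! i) (insert_nth a y xs ! i)) = prod_list (map2 F ks (insert_nth a y xs))"
    using assms by (intro prod_nth2_eq_prod_list) auto
  also have "\<dots> = prod_list (map2 F (take a ks) (take a xs)) * (F (ks ! a) y *
      prod_list (map2 F (drop (Suc a) ks) (drop a xs)))"
    using assms by (subst ks) (simp add: insert_nth_def)
  also have "\<dots> = F (ks ! a) y * prod_list (map2 F (remove_nth a ks) (take a xs @ drop a xs))"
    using assms unfolding remove_nth_def by (subst zip_append) (auto simp: mult_ac)
  also have "prod_list (map2 F (remove_nth a ks) (take a xs @ drop a xs)) =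
      (\<Prod>i<s. F (remove_nth a ks ! i) (xs ! i))"
    using assms by (subst prod_nth2_eq_prod_list) auto
  finally show ?thesis .
qed

section \<open>The position of a largest part\<close>

text \<open>An arbitrary choice breaks ties, so that every nonempty list falls into exactly one
  group. The choice does not affect the limit: for fixed other parts and large \<open>n\<close>
  there is no tie.\<close>

definition max_pos :: "nat list \<Rightarrow> nat" where
  "max_pos ms = (SOME a. a < length ms \<and> (\<forall>m\<in>set ms. m \<le> ms ! a))"

lemma max_pos:
  assumes "ms \<noteq> []"
  shows "max_pos ms < length ms" and "m \<in> set ms \<Longrightarrow> m \<le> ms ! max_pos ms"
proof -
  obtain a where "a < length ms" "ms ! a = Max (set ms)"
    using assms Max_in[of "set ms"] by (auto simp: in_set_conv_nth)
  then have "a < length ms \<and> (\<forall>m\<in>set ms. m \<le> ms ! a)" by auto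
  from someI[of "\<lambda>a. a < length ms \<and> (\<forall>m\<in>set ms. m \<le> ms ! a)", OF this]
  show "max_pos ms < length ms" "m \<in> set ms \<Longrightarrow> m \<le> ms ! max_pos ms"
    by (auto simp: max_pos_def)
qed

text \<open>A strictly largest entry leaves \<open>SOME\<close> no alternative.\<close>

lemma max_pos_insert_nth:
  assumes "a \<le> length xs" "\<And>x. x \<in> set xs \<Longrightarrow> x < y"
  shows "max_pos (insert_nth a y xs) = a"
proof (rule ccontr)
  let ?ms = "insert_nth a y xs"
  assume "max_pos ?ms \<noteq> a"
  moreover have len: "max_pos ?ms < length ?ms"
    by (rule max_pos) simp
  ultimately have "?ms ! max_pos ?ms \<in> set xs"
    using assms by (auto simp: nth_insert_nth)
  then have "?ms ! max_pos ?ms < y" by (rule assms)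
  moreover have "y \<le> ?ms ! max_pos ?ms"
    by (rule max_pos) auto
  ultimately show False by simp
qed

section \<open>Grouping the compositions and passing to the limit\<close>

lemma finite_pos_lists_sum_less: "finite {xs \<in> pos_lists s. sum_list xs < n}"
proof (rule finite_subset)
  show "{xs \<in> pos_lists s. sum_list xs < n} \<subseteq> {xs. set xs \<subseteq> {..n} \<and> length xs = s}"
    by (auto simp: pos_lists_def dest: member_le_sum_list)
qed (simp add: finite_lists_length_eq)

lemma finite_compositions: "finite (compositions r n)"
proof (rule finite_subset)
  show "compositions r n \<subseteq> {xs \<in> pos_lists r. sum_list xs < Suc n}"
    by (auto simp: compositions_def pos_lists_def)
qed (rule finite_pos_lists_sum_less)

lemma omega_root_eq:
  "omega_root ks n =
     (\<Sum>ms\<in>compositions (length ks) n. \<Prod>i<length ks. summand n (ks ! i) (ms ! i))"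
  by (simp add: omega_root_def omega_def summand_def unity_root_def)

text \<open>The sum over a group becomes an unordered sum over \<open>pos_lists s\<close>, a set
  independent of \<open>n\<close>, with zero terms outside \<open>B n\<close>. Then
  \<open>tendsto_infsum_dominated\<close> applies.\<close>

lemma tendsto_sum_compositions_max_pos:
  assumes ks: "is_index ks" "length ks = Suc s" and s: "s > 0" and a: "a \<le> s"
  shows "(\<lambda>n. \<Sum>ms | ms \<in> compositions (Suc s) n \<and> max_pos ms = a.
              \<Prod>i<Suc s. summand n (ks ! i) (ms ! i))
           \<longlonglongrightarrow> (-1) ^ (ks ! a) * complex_of_real (zeta_MT (remove_nth a ks) (ks ! a))"
proof -
  define ls where "ls = remove_nth a ks"
  define l where "l = ks ! a"
  have ls: "length ls = s" "is_index ls"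
    using ks a set_remove_nth_subset[of a ks] by (auto simp: ls_def is_index_def)
  have l: "0 < l" using ks a by (simp add: l_def is_index_def)
  \<comment> \<open>The lists of other parts that occur in the group at \<open>a\<close>; the strict
    inequality makes the restored part positive.\<close>
  define B where "B n = {xs \<in> pos_lists s. sum_list xs < n \<and>
      max_pos (insert_nth a (n - sum_list xs) xs) = a}" for n
  have finB: "finite (B n)" for n
    by (rule finite_subset[OF _ finite_pos_lists_sum_less[of s n]]) (auto simp: B_def)
  define t where "t n xs = summand n l (n - sum_list xs) * (\<Prod>i<s. summand n (ls ! i) (xs ! i))" for n xs
  define z where "z xs = 1 / ((\<Prod>i<s. real (xs ! i) ^ (ls ! i)) * real (sum_list xs) ^ l)" for xs
  \<comment> \<open>The powers of \<open>pi / 2\<close> come from \<open>norm_summand_le\<close>,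
    and \<open>s ^ l\<close> from its use with \<open>d = M / s\<close> for the part at
    \<open>a\<close>.\<close>
  define C where "C = (pi / 2) ^ l * real s ^ l * (\<Prod>i<s. (pi / 2) ^ (ls ! i))"

  have sum_eq: "(\<Sum>ms | ms \<in> compositions (Suc s) n \<and> max_pos ms = a.
      \<Prod>i<Suc s. summand n (ks ! i) (ms ! i)) =
      (\<Sum>\<^sub>\<infinity>xs\<in>pos_lists s. if xs \<in> B n then t n xs else 0)" (is "?L = ?R") for n
  proof -
    \<comment> \<open>The part at \<open>a\<close> is determined by the others and the total
      \<open>n\<close>, so removing it is injective.\<close>
    have ins: "insert_nth a (n - sum_list (remove_nth a ms)) (remove_nth a ms) = ms"
      "sum_list (remove_nth a ms) < n" "remove_nth a ms \<in> pos_lists s"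
      if "ms \<in> compositions (Suc s) n" for ms
    proof -
      have ms: "length ms = Suc s" "\<forall>m\<in>set ms. m > 0" "sum_list ms = n"
        using that by (auto simp: compositions_def)
      have eq: "insert_nth a (ms ! a) (remove_nth a ms) = ms" using ms a by simp
      have sum: "ms ! a + sum_list (remove_nth a ms) = n"
        using ms by (metis eq sum_list_insert_nth)
      have "ms ! a > 0" using ms a by simp
      then show "sum_list (remove_nth a ms) < n" using sum by simp
      show "insert_nth a (n - sum_list (remove_nth a ms)) (remove_nth a ms) = ms"
        using eq sum by auto
      show "remove_nth a ms \<in> pos_lists s"
        using ms a set_remove_nth_subset[of a ms] by (auto simp: pos_lists_def)
    qed
    have "?L = (\<Sum>xs\<in>B n. t n xs)"
    proof (rule sum.reindex_bij_witness[of _ "\<lambda>xs. insert_nth a (n - sum_list xs) xs" "remove_nth a"])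
      fix ms assume ms: "ms \<in> {ms. ms \<in> compositions (Suc s) n \<and> max_pos ms = a}"
      then have len: "length (remove_nth a ms) = s" using ins by (auto simp: pos_lists_def)
      show "t n (remove_nth a ms) = (\<Prod>i<Suc s. summand n (ks ! i) (ms ! i))"
        using prod_insert_nth[OF ks(2) len a, of "summand n" "n - sum_list (remove_nth a ms)"] ins ms
        by (simp add: t_def ls_def l_def)
    qed (use ins a in \<open>auto simp: B_def compositions_def pos_lists_def\<close>)
    also have "\<dots> = (\<Sum>\<^sub>\<infinity>xs\<in>B n. t n xs)" using finB by simp
    also have "\<dots> = ?R" by (rule infsum_cong_neutral) (auto simp: B_def)
    finally show ?thesis .
  qed

  have zs: "z summable_on pos_lists s"
    using zeta_MT_summable[OF ls(2) _ l] ls s unfolding z_def by auto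
  have "(\<lambda>n. \<Sum>\<^sub>\<infinity>xs\<in>pos_lists s. if xs \<in> B n then t n xs else 0)
      \<longlonglongrightarrow> (\<Sum>\<^sub>\<infinity>xs\<in>pos_lists s. (-1) ^ l * complex_of_real (z xs))"
  proof (rule tendsto_infsum_dominated)
    show "(\<lambda>xs. C * z xs) summable_on pos_lists s"
      using zs by (rule summable_on_cmult_right)
  next
    fix n xs assume xs: "xs \<in> pos_lists s"
    then have len: "length xs = s" by (simp add: pos_lists_def)
    have z_nonneg: "0 \<le> C * z xs"
      by (auto simp: C_def z_def intro!: mult_nonneg_nonneg prod_nonneg divide_nonneg_nonneg)
    show "norm (if xs \<in> B n then t n xs else 0) \<le> C * z xs"
    proof (cases "xs \<in> B n")
      case True
      define M where "M = sum_list xs"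
      define y where "y = n - M"
      have n: "n = M + y" "y > 0" using True by (auto simp: B_def M_def y_def)
      have pos: "0 < xs ! i" if "i < s" for i using xs that by (auto simp: pos_lists_def)
      have le_M: "xs ! i \<le> M" if "i < s" for i
        using that len by (simp add: M_def elem_le_sum_list)
      have M: "M > 0" using le_M[of 0] pos[of 0] s by simp
      have mp: "max_pos (insert_nth a y xs) = a" using True by (simp add: B_def y_def M_def)
      have le_y: "x \<le> y" if "x \<in> set xs" for x
        using max_pos(2)[of "insert_nth a y xs" x] that mp a len
        by (auto simp: nth_insert_nth)
      \<comment> \<open>Each of the \<open>s\<close> other parts is at most \<open>y\<close>. Hence
        \<open>M / s\<close> is at most \<open>y\<close> and also at most \<open>M = n - y\<close>,
        as \<open>norm_summand_le\<close> requires.\<close>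
      have "M \<le> s * y"
        using sum_list_mono[of xs "\<lambda>x. x" "\<lambda>_. y"] le_y len
        by (simp add: M_def sum_list_triv)
      then have "real M / s \<le> y"
        using s by (simp add: divide_le_eq mult.commute flip: of_nat_mult)
      moreover have "real M / s \<le> M"
        using s divide_left_mono[of 1 "real s" "real M"] by simp
      ultimately have 1: "norm (summand n l y) \<le> (pi / 2) ^ l / (real M / s) ^ l"
        using n M s by (intro norm_summand_le) auto
      have 2: "norm (summand n (ls ! i) (xs ! i)) \<le> (pi / 2) ^ (ls ! i) / real (xs ! i) ^ (ls ! i)"
        if i: "i < s" for i
      proof (rule norm_summand_le)
        \<comment> \<open>As the part is at most \<open>y\<close> and at most \<open>M\<close>, its
          double is at most \<open>n = M + y\<close>; hence \<open>d\<close> can be the part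
          itself.\<close>
        have "xs ! i \<le> y" using le_y i len by simp
        then have "xs ! i + xs ! i \<le> n" using le_M[OF i] n by simp
        then show "real (xs ! i) \<le> real n - real (xs ! i)" by linarith
        show "xs ! i < n" using le_M[OF i] n by simp
      qed (use pos[OF i] in auto)
      have "norm (t n xs) = norm (summand n l y) * (\<Prod>i<s. norm (summand n (ls ! i) (xs ! i)))"
        by (simp add: t_def norm_mult prod_norm y_def M_def)
      also have "\<dots> \<le> ((pi / 2) ^ l / (real M / s) ^ l) *
          (\<Prod>i<s. (pi / 2) ^ (ls ! i) / real (xs ! i) ^ (ls ! i))"
        using 1 2 by (intro mult_mono prod_mono) (auto intro!: prod_nonneg)
      also have "\<dots> = C * z xs"
        by (simp add: C_def z_def M_def prod_dividef power_divide prod.distrib mult_ac)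
      finally show ?thesis using True by simp
    qed (use z_nonneg in simp)
  next
    fix xs assume xs: "xs \<in> pos_lists s"
    then have len: "length xs = s" by (simp add: pos_lists_def)
    have pos: "0 < xs ! i" if "i < s" for i using xs that by (auto simp: pos_lists_def)
    have M: "sum_list xs > 0"
      using elem_le_sum_list[of 0 xs] pos[of 0] s len by simp
    \<comment> \<open>Then the part at \<open>a\<close> exceeds the total of the others, so it is
      strictly largest and the list lies in \<open>B n\<close>.\<close>
    have "t n xs = (if xs \<in> B n then t n xs else 0)" if n: "n > 2 * sum_list xs" for n
    proof -
      have "max_pos (insert_nth a (n - sum_list xs) xs) = a"
      proof (rule max_pos_insert_nth)
        fix x assume "x \<in> set xs"
        then show "x < n - sum_list xs" using member_le_sum_list[of x xs] n by simp
      qed (use a len in simp)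
      then show ?thesis using xs n by (simp add: B_def)
    qed
    then have ev: "\<forall>\<^sub>F n in sequentially. t n xs = (if xs \<in> B n then t n xs else 0)"
      using eventually_gt_at_top[of "2 * sum_list xs"] by (rule eventually_mono[rotated])
    have "(\<lambda>n. t n xs) \<longlonglongrightarrow> ((-1) ^ l / of_nat (sum_list xs) ^ l) * (\<Prod>i<s. 1 / of_nat (xs ! i) ^ (ls ! i))"
      unfolding t_def using M pos
      by (intro tendsto_intros tendsto_summand tendsto_summand_diff) auto
    also have "((-1) ^ l / of_nat (sum_list xs) ^ l) * (\<Prod>i<s. 1 / of_nat (xs ! i) ^ (ls ! i)) =
        (-1) ^ l * complex_of_real (z xs)"
      by (simp add: z_def prod_dividef mult_ac)
    finally show "(\<lambda>n. if xs \<in> B n then t n xs else 0) \<longlonglongrightarrow> (-1) ^ l * complex_of_real (z xs)"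
      using ev by (rule Lim_transform_eventually)
  qed
  also have "(\<Sum>\<^sub>\<infinity>xs\<in>pos_lists s. (-1) ^ l * complex_of_real (z xs)) =
      (-1) ^ l * complex_of_real (zeta_MT ls l)"
  proof -
    have "infsum z (pos_lists s) = zeta_MT ls l"
      by (simp add: zeta_MT_def ls z_def[abs_def] pos_lists_def)
    then have "(\<Sum>\<^sub>\<infinity>xs\<in>pos_lists s. complex_of_real (z xs)) = complex_of_real (zeta_MT ls l)"
      using zs by (metis has_sum_infsum has_sum_of_real infsumI)
    then show ?thesis by (simp add: infsum_cmult_right')
  qed
  finally show ?thesis
    by (simp only: sum_eq ls_def l_def)
qed

theorem theorem1p3:
  fixes ks :: "nat list"
  assumes "is_index ks" and "length ks \<ge> 2"
  shows "convergent (omega_root ks) \<and>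
         Omega ks = (\<Sum>a<length ks. (-1) ^ (ks ! a) * complex_of_real (zeta_MT (remove_nth a ks) (ks ! a)))"
proof -
  obtain s where s: "length ks = Suc s" "s > 0"
    using assms(2) by (cases "length ks") auto
  have "omega_root ks n = (\<Sum>a<length ks. \<Sum>ms | ms \<in> compositions (length ks) n \<and> max_pos ms = a.
      \<Prod>i<length ks. summand n (ks ! i) (ms ! i))" for n
  proof -
    \<comment> \<open>The groups at the positions below \<open>length ks\<close> therefore exhaust
      the compositions.\<close>
    have "max_pos ms < length ks" if "ms \<in> compositions (length ks) n" for ms
      using that s max_pos(1)[of ms] by (fastforce simp: compositions_def)
    then show ?thesis unfolding omega_root_eq
      by (intro sum.group[symmetric] finite_compositions) auto
  qed
  \<comment> \<open>The number of groups does not depend on \<open>n\<close>, so their limits add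
    up.\<close>
  moreover have "(\<lambda>n. \<Sum>a<length ks. \<Sum>ms | ms \<in> compositions (length ks) n \<and> max_pos ms = a.
      \<Prod>i<length ks. summand n (ks ! i) (ms ! i)) \<longlonglongrightarrow>
      (\<Sum>a<length ks. (-1) ^ (ks ! a) * complex_of_real (zeta_MT (remove_nth a ks) (ks ! a)))"
    unfolding s(1)
    by (intro tendsto_sum tendsto_sum_compositions_max_pos assms s) auto
  ultimately have "omega_root ks \<longlonglongrightarrow>
      (\<Sum>a<length ks. (-1) ^ (ks ! a) * complex_of_real (zeta_MT (remove_nth a ks) (ks ! a)))"
    by presburger
  then show ?thesis
    by (auto simp: Omega_def convergent_def intro: limI)
qed

end
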